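(* Let $L=L_{\bar 0}\oplus L_{\bar 1}$ be a Lie superalgebra whose commutator set $S=\{[x,y]: x,y\in L\}$ is finite. Then $L^2$ is finite dimensional. Further, if $L/Z(L)$ is finitely generated by $(m\mid n)$ elements, then $L/Z(L)$ is finite dimensional; more precisely, $$\dim\left(L/Z(L)\right)\le (m+n)\dim L^2 .$$
   Context: All vector superspaces are over a field $\mathbb{F}$ of characteristic different from $2$ and $3$. A Lie superalgebra is a $\mathbb{Z}_2$-graded vector space $L=L_{\bar 0}\oplus L_{\bar 1}$ with a bilinear bracket satisfying, for homogeneous elements, $[L_\alpha,L_\beta]\subseteq L_{\alpha+\beta}$, $[x,y]=-(-1)^{|x||y|}[y,x]$, and $(-1)^{|x||z|}[x,[y,z]]+(-1)^{|y||x|}[y,[z,x]]+(-1)^{|z||y|}[z,[x,y]]=0$. $L^2=[L,L]$ is the span of all $[x,y]$, $x,y\in L$, and $Z(L)=\{z\in L: [z,x]=0 \text{ for all } x\in L\}$. "Generated by $(m\mid n)$ elements" means generated, as a Lie superalgebra, by $m$ even and $n$ odd elements. In the displayed inequality $\dim$ denotes the total vector space dimension (even plus odd). *)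

theory Defs
  imports
    "Jordan_Normal_Form.Missing_VectorSpace"
    "HOL-Algebra.QuotRing"
    "HOL-Library.Z2"
begin

text \<open>
  Vector spaces over a field \<open>K\<close> are those of the locale \<^locale>\<open>vectorspace\<close>, with its
  \<open>subspace\<close>, \<open>span\<close>, \<open>fin_dim\<close> and \<open>dim\<close>. As usual for module records over HOL-Algebra rings,
  the inherited fields \<open>mult\<close> and \<open>one\<close> carry no meaning.
\<close>

definition field_char :: "('a, 'm) ring_scheme \<Rightarrow> nat" where
  "field_char R =
     (if \<exists>n::nat. 0 < n \<and> [n] \<cdot>\<^bsub>R\<^esub> \<one>\<^bsub>R\<^esub> = \<zero>\<^bsub>R\<^esub> then LEAST n::nat. 0 < n \<and> [n] \<cdot>\<^bsub>R\<^esub> \<one>\<^bsub>R\<^esub> = \<zero>\<^bsub>R\<^esub>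
      else 0)"

text \<open>The degrees live in \<open>\<int>\<^sub>2\<close>, represented by the type \<^typ>\<open>bit\<close>.\<close>

record ('a, 'b) superalg = "('a, 'b) module" +
  grade :: "bit \<Rightarrow> 'b set"
  bracket :: "'b \<Rightarrow> 'b \<Rightarrow> 'b"

text \<open>\<open>super_sign K \<alpha> \<beta>\<close> is the scalar $(-1)^{\alpha\beta}$.\<close>

definition super_sign :: "('a, 'm) ring_scheme \<Rightarrow> bit \<Rightarrow> bit \<Rightarrow> 'a" where
  "super_sign K \<alpha> \<beta> = (if \<alpha> * \<beta> = 1 then \<ominus>\<^bsub>K\<^esub> \<one>\<^bsub>K\<^esub> else \<one>\<^bsub>K\<^esub>)"

locale lie_superalgebra = vectorspace K L
  for K :: "('a, 'm) ring_scheme" and L :: "('a, 'b, 'n) superalg_scheme" +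
  assumes grade_subspace: "subspace K (grade L \<alpha>) L"
    and grade_sum: "grade L 0 <+>\<^bsub>L\<^esub> grade L 1 = carrier L"
    and grade_disjoint: "grade L 0 \<inter> grade L 1 = {\<zero>\<^bsub>L\<^esub>}"
    and bracket_closed:
      "\<lbrakk>x \<in> carrier L; y \<in> carrier L\<rbrakk> \<Longrightarrow> bracket L x y \<in> carrier L"
    and bracket_add_left:
      "\<lbrakk>x \<in> carrier L; y \<in> carrier L; z \<in> carrier L\<rbrakk>
       \<Longrightarrow> bracket L (x \<oplus>\<^bsub>L\<^esub> y) z = bracket L x z \<oplus>\<^bsub>L\<^esub> bracket L y z"
    and bracket_add_right:
      "\<lbrakk>x \<in> carrier L; y \<in> carrier L; z \<in> carrier L\<rbrakk>
       \<Longrightarrow> bracket L x (y \<oplus>\<^bsub>L\<^esub> z) = bracket L x y \<oplus>\<^bsub>L\<^esub> bracket L x z"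
    and bracket_smult_left:
      "\<lbrakk>c \<in> carrier K; x \<in> carrier L; y \<in> carrier L\<rbrakk>
       \<Longrightarrow> bracket L (c \<odot>\<^bsub>L\<^esub> x) y = c \<odot>\<^bsub>L\<^esub> bracket L x y"
    and bracket_smult_right:
      "\<lbrakk>c \<in> carrier K; x \<in> carrier L; y \<in> carrier L\<rbrakk>
       \<Longrightarrow> bracket L x (c \<odot>\<^bsub>L\<^esub> y) = c \<odot>\<^bsub>L\<^esub> bracket L x y"
    and bracket_grade:
      "\<lbrakk>x \<in> grade L \<alpha>; y \<in> grade L \<beta>\<rbrakk> \<Longrightarrow> bracket L x y \<in> grade L (\<alpha> + \<beta>)"
    and super_skew:
      "\<lbrakk>x \<in> grade L \<alpha>; y \<in> grade L \<beta>\<rbrakk>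
       \<Longrightarrow> bracket L x y = \<ominus>\<^bsub>L\<^esub> (super_sign K \<alpha> \<beta> \<odot>\<^bsub>L\<^esub> bracket L y x)"
    and super_jacobi:
      "\<lbrakk>x \<in> grade L \<alpha>; y \<in> grade L \<beta>; z \<in> grade L \<gamma>\<rbrakk>
       \<Longrightarrow> super_sign K \<alpha> \<gamma> \<odot>\<^bsub>L\<^esub> bracket L x (bracket L y z)
         \<oplus>\<^bsub>L\<^esub> super_sign K \<beta> \<alpha> \<odot>\<^bsub>L\<^esub> bracket L y (bracket L z x)
         \<oplus>\<^bsub>L\<^esub> super_sign K \<gamma> \<beta> \<odot>\<^bsub>L\<^esub> bracket L z (bracket L x y) = \<zero>\<^bsub>L\<^esub>"

definition commutators :: "('a, 'b, 'n) superalg_scheme \<Rightarrow> 'b set" where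
  "commutators L = {bracket L x y | x y. x \<in> carrier L \<and> y \<in> carrier L}"

definition derived :: "('a, 'm) ring_scheme \<Rightarrow> ('a, 'b, 'n) superalg_scheme \<Rightarrow> 'b set" where
  "derived K L = module.span K L (commutators L)"

definition center :: "('a, 'b, 'n) superalg_scheme \<Rightarrow> 'b set" where
  "center L = {z \<in> carrier L. \<forall>x\<in>carrier L. bracket L z x = \<zero>\<^bsub>L\<^esub>}"

text \<open>
  The quotient by a graded ideal \<open>I\<close>, as in \<^const>\<open>FactRing\<close>: scalar multiplication and bracket of
  cosets are unions of the cosets of the results on representatives, which all coincide.
\<close>

definition quotient_superalg ::
    "('a, 'b, 'n) superalg_scheme \<Rightarrow> 'b set \<Rightarrow> ('a, 'b set) superalg" where
  "quotient_superalg L I =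
     \<lparr>carrier = a_rcosets\<^bsub>L\<^esub> I, mult = (\<lambda>_ _. I), one = I, zero = I, add = set_add L,
      smult = (\<lambda>c X. \<Union>x\<in>X. I +>\<^bsub>L\<^esub> (c \<odot>\<^bsub>L\<^esub> x)),
      grade = (\<lambda>\<alpha>. (\<lambda>x. I +>\<^bsub>L\<^esub> x) ` grade L \<alpha>),
      bracket = (\<lambda>X Y. \<Union>x\<in>X. \<Union>y\<in>Y. I +>\<^bsub>L\<^esub> bracket L x y)\<rparr>"

definition sub_superalgebra ::
    "('a, 'm) ring_scheme \<Rightarrow> 'b set \<Rightarrow> ('a, 'b, 'n) superalg_scheme \<Rightarrow> bool" where
  "sub_superalgebra K H L \<longleftrightarrow>
     subspace K H L \<and>
     H = (H \<inter> grade L 0) <+>\<^bsub>L\<^esub> (H \<inter> grade L 1) \<and>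
     (\<forall>x\<in>H. \<forall>y\<in>H. bracket L x y \<in> H)"

definition generated_superalgebra ::
    "('a, 'm) ring_scheme \<Rightarrow> ('a, 'b, 'n) superalg_scheme \<Rightarrow> 'b set \<Rightarrow> 'b set" where
  "generated_superalgebra K L X = \<Inter>{H. sub_superalgebra K H L \<and> X \<subseteq> H}"

text \<open>
  Generators form lists, so repetitions (and zero, which is both even and odd) are allowed:
  \<open>(m | n)\<close> elements means at most \<open>m\<close> distinct even and at most \<open>n\<close> distinct odd ones.
\<close>

definition generated_by ::
    "('a, 'm) ring_scheme \<Rightarrow> ('a, 'b, 'n) superalg_scheme \<Rightarrow> nat \<Rightarrow> nat \<Rightarrow> bool" where
  "generated_by K L m n \<longleftrightarrow>
     (\<exists>xs ys. length xs = m \<and> set xs \<subseteq> grade L 0 \<and>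
              length ys = n \<and> set ys \<subseteq> grade L 1 \<and>
              generated_superalgebra K L (set xs \<union> set ys) = carrier L)"

end

theory Submission
  imports Defs
begin

text \<open>
  If \<open>x\<^sub>1, \<dots>, x\<^sub>r\<close> are homogeneous and generate \<open>L\<close> modulo the center, then an element commuting with
  all of them is central: its homogeneous components commute with them as well, and the centralizer
  of a homogeneous element is a graded subalgebra containing the center. So
  \<open>x \<mapsto> ([x, x\<^sub>1], \<dots>, [x, x\<^sub>r])\<close> has kernel \<open>Z(L)\<close> and takes values in the \<open>r\<close>-th power of \<open>L\<^sup>2\<close>.
\<close>

section \<open>Submodules and spans under linear maps\<close>

lemma (in module) submodule_vimage:
  assumes hom: "mod_hom R M N f" and P: "submodule R P N"
  shows "submodule R {x \<in> carrier M. f x \<in> P} M"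
proof -
  interpret f: mod_hom R M N f by (rule hom)
  interpret P: submodule R P N by (rule P)
  show ?thesis
    by (rule submodule.intro) (auto intro: module_axioms)
qed

lemma (in mod_hom) submodule_image:
  assumes P: "submodule R P M"
  shows "submodule R (f ` P) N"
proof -
  interpret P: submodule R P M by (rule P)
  have sub: "\<And>x. x \<in> P \<Longrightarrow> x \<in> carrier M"
    using P.subset by blast
  show ?thesis
  proof (rule submodule.intro)
    show "module R N" ..
    show "f ` P \<subseteq> carrier N"
      using sub by auto
    show "\<zero>\<^bsub>N\<^esub> \<in> f ` P"
      using P.zero_closed f0_is_0 by (metis imageI)
  next
    fix v w assume "v \<in> f ` P" "w \<in> f ` P"
    then obtain x y where "x \<in> P" "y \<in> P" "v = f x" "w = f y" by blast
    then show "v \<oplus>\<^bsub>N\<^esub> w \<in> f ` P"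
      using sub P.m_closed by (metis f_add imageI)
  next
    fix c v assume c: "c \<in> carrier R" and "v \<in> f ` P"
    then obtain x where "x \<in> P" "v = f x" by blast
    then show "c \<odot>\<^bsub>N\<^esub> v \<in> f ` P"
      using c sub P.smult_closed by (metis f_smult imageI)
  qed
qed

lemma (in mod_hom) span_image_subset:
  assumes S: "S \<subseteq> carrier M"
  shows "N.span (f ` S) \<subseteq> f ` M.span S"
  using M.in_own_span[OF S] by (intro N.span_is_subset submodule_image M.span_is_submodule S) auto

section \<open>Spanning sets bounded by the dimension of a target space\<close>

text \<open>Take a maximal independent subset of \<open>U\<close>: independent sets have at most
  \<open>dim\<close> elements, so one exists, and maximality puts the rest of \<open>U\<close> in
  its span. \<open>B\<close> stays inside \<open>U\<close> so that, when \<open>U\<close> is the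
  image of a map, its elements can be lifted.\<close>

lemma (in vectorspace) subspace_spanning_set:
  assumes fd: "fin_dim" and U: "U \<subseteq> carrier V"
  obtains B where "finite B" "B \<subseteq> U" "card B \<le> dim" "U \<subseteq> span B"
proof -
  have "lin_indpt {}"
    by (auto simp: lin_dep_def)
  then have "\<exists>B. finite B \<and> maximal B (\<lambda>S. S \<subseteq> U \<and> lin_indpt S)"
    using li_le_dim[OF fd] U by (intro maximal_exists[where N = dim and B = "{}"]) auto
  then obtain B where fin: "finite B" and maxB: "maximal B (\<lambda>S. S \<subseteq> U \<and> lin_indpt S)"
    by (elim exE conjE)
  have B: "finite B" "B \<subseteq> U" "lin_indpt B"
    using fin maxB by (simp_all add: maximal_def)
  have BV: "B \<subseteq> carrier V"
    using B U by blast
  have "U \<subseteq> span B"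
  proof
    fix u assume u: "u \<in> U"
    show "u \<in> span B"
    proof (cases "u \<in> B")
      case True
      then show ?thesis using in_own_span[OF BV] by blast
    next
      case False
      then have "B \<union> {u} \<noteq> B" by blast
      then have "lin_dep (B \<union> {u})"
        using maxB u by (auto simp: maximal_def)
      then show ?thesis
        using lin_dep_iff_in_span[OF BV B(3) _ False] u U by blast
    qed
  qed
  then show thesis
    using that[OF B(1,2) _] li_le_dim(2)[OF fd BV B(3)] by blast
qed

text \<open>One step per map: on \<open>U\<close> modulo the kernel of the first map at most \<open>dim W\<close> vectors are
  needed, and the remaining maps take care of \<open>U\<close> intersected with that kernel.\<close>

lemma joint_kernel_spanning_set:
  assumes W: "vectorspace K W" and fd: "vectorspace.fin_dim K W"
    and V: "vectorspace K V"
    and hom: "\<And>f. f \<in> set fs \<Longrightarrow> mod_hom K V W f"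
    and U: "submodule K U V" and Z: "Z \<subseteq> carrier V"
    and ker: "{u \<in> U. \<forall>f\<in>set fs. f u = \<zero>\<^bsub>W\<^esub>} \<subseteq> Z"
  shows "\<exists>A. finite A \<and> A \<subseteq> carrier V \<and> card A \<le> length fs * vectorspace.dim K W \<and>
    U \<subseteq> module.span K V (A \<union> Z)"
  using hom U ker
proof (induction fs arbitrary: U)
  case Nil
  interpret V: vectorspace K V by (rule V)
  have "U \<subseteq> V.span Z"
    using Nil V.in_own_span[OF Z] by auto
  then show ?case by (intro exI[of _ "{}"]) simp
next
  case (Cons f fs)
  interpret V: vectorspace K V by (rule V)
  interpret W: vectorspace K W by (rule W)
  interpret f: mod_hom K V W f by (rule Cons.prems) simp
  interpret U: submodule K U V by (rule Cons.prems)
  define U' where "U' = {u \<in> U. f u = \<zero>\<^bsub>W\<^esub>}"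
  have Usub: "U \<subseteq> carrier V" by (rule U.subset)
  have U': "submodule K U' V"
    by (rule submodule.intro) (use Usub in \<open>auto simp: U'_def V.module_axioms subset_eq\<close>)
  \<comment> \<open>Since \<open>f\<close> vanishes on \<open>U'\<close>, the common zeros of
    \<open>fs\<close> in \<open>U'\<close> are those of \<open>f # fs\<close> in \<open>U\<close>,
    so they lie in \<open>Z\<close> and the induction hypothesis applies.\<close>
  have "\<exists>A. finite A \<and> A \<subseteq> carrier V \<and> card A \<le> length fs * W.dim \<and> U' \<subseteq> V.span (A \<union> Z)"
    using Cons.prems by (intro Cons.IH U') (auto simp: U'_def)
  then obtain A where A: "finite A" "A \<subseteq> carrier V" "card A \<le> length fs * W.dim"
    "U' \<subseteq> V.span (A \<union> Z)" by blast
  have "f ` U \<subseteq> carrier W"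
    using Usub by auto
  then obtain B where B: "finite B" "B \<subseteq> f ` U" "card B \<le> W.dim" "f ` U \<subseteq> W.span B"
    using W.subspace_spanning_set[OF fd] by metis
  \<comment> \<open>One preimage in \<open>U\<close> for each element of \<open>B\<close>, so the
    cardinality is unchanged.\<close>
  obtain C where C: "C \<subseteq> U" "finite C" "f ` C = B" "card C = card B"
    using B(1,2) by (metis finite_imageD card_image subset_image_inj)
  have CV: "C \<subseteq> carrier V" and AC: "(C \<union> A) \<union> Z \<subseteq> carrier V"
    using C Usub A Z by auto
  interpret S: submodule K "V.span ((C \<union> A) \<union> Z)" V
    by (rule V.span_is_submodule[OF AC])
  have "u \<in> V.span ((C \<union> A) \<union> Z)" if u: "u \<in> U" for u
  proof -
    \<comment> \<open>The vector \<open>u\<close> is corrected by some \<open>v\<close> in the span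
      of \<open>C\<close> with the same image; then \<open>u - v\<close> lies in \<open>U'\<close>,
      which \<open>A\<close> and \<open>Z\<close> span.\<close>
    have "f u \<in> f ` V.span C"
      using B(4) C(3) u f.span_image_subset[OF CV] by blast
    then obtain v where v: "v \<in> V.span C" "f u = f v" by blast
    have vU: "v \<in> U"
      using V.span_is_subset[OF C(1) Cons.prems(2)] v by blast
    have cv: "u \<in> carrier V" "v \<in> carrier V"
      using u vU Usub by auto
    have "(\<ominus>\<^bsub>K\<^esub> \<one>\<^bsub>K\<^esub>) \<odot>\<^bsub>V\<^esub> v \<in> U"
      using vU by (intro U.smult_closed) auto
    then have "u \<ominus>\<^bsub>V\<^esub> v \<in> U"
      using u cv by (simp add: V.smult_minus_1 a_minus_def U.m_closed)
    moreover have "f (u \<ominus>\<^bsub>V\<^esub> v) = \<zero>\<^bsub>W\<^esub>"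
      using cv v(2) by simp
    ultimately have "u \<ominus>\<^bsub>V\<^esub> v \<in> V.span ((C \<union> A) \<union> Z)"
      using A(4) V.span_is_monotone[of "A \<union> Z" "(C \<union> A) \<union> Z"] unfolding U'_def by blast
    moreover have "v \<in> V.span ((C \<union> A) \<union> Z)"
      using v(1) V.span_is_monotone[of C "(C \<union> A) \<union> Z"] by blast
    ultimately have "(u \<ominus>\<^bsub>V\<^esub> v) \<oplus>\<^bsub>V\<^esub> v \<in> V.span ((C \<union> A) \<union> Z)"
      by (rule S.m_closed)
    moreover have "(u \<ominus>\<^bsub>V\<^esub> v) \<oplus>\<^bsub>V\<^esub> v = u"
      using cv by (simp add: a_minus_def V.M.a_assoc V.M.l_neg)
    ultimately show ?thesis by simp
  qed
  moreover have "card (C \<union> A) \<le> length (f # fs) * W.dim"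
    using card_Un_le[of C A] C(4) B(3) A(3) by simp
  ultimately show ?case
    using C(2) A(1) AC by (intro exI[of _ "C \<union> A"]) auto
qed

section \<open>The quotient by a submodule as a vector space\<close>

text \<open>The coset map is onto and turns the operations of \<open>L\<close> into those of the
  quotient, so each vector space axiom is inherited from \<open>L\<close>. The bracket is left
  aside: for a mere submodule it need not be well defined on cosets.\<close>

lemma
  fixes L :: "('a, 'b, 'n) superalg_scheme"
  assumes L: "vectorspace K L" and I: "submodule K I L"
  shows vectorspace_quotient: "vectorspace K (quotient_superalg L I)"
    and mod_hom_quotient: "mod_hom K L (quotient_superalg L I) (a_r_coset L I)"
    and coset_eq_zero: "x \<in> I \<Longrightarrow> a_r_coset L I x = \<zero>\<^bsub>quotient_superalg L I\<^esub>"
proof -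
  interpret L: vectorspace K L by (rule L)
  interpret I: submodule K I L by (rule I)
  let ?Q = "quotient_superalg L I" and ?c = "a_r_coset L I"
  have sub: "I \<subseteq> carrier L" by (rule I.subset)
  \<comment> \<open>The coset calculus needs an additive subgroup; closure under negation comes from
    the scalar -1.\<close>
  have "subgroup I (add_monoid L)"
  proof (rule group.subgroupI[OF L.M.a_group])
    fix a assume a: "a \<in> I"
    then have "(\<ominus>\<^bsub>K\<^esub> \<one>\<^bsub>K\<^esub>) \<odot>\<^bsub>L\<^esub> a \<in> I"
      by (intro I.smult_closed) auto
    then show "inv\<^bsub>add_monoid L\<^esub> a \<in> I"
      using L.smult_minus_1[of a] a sub unfolding a_inv_def[symmetric] by (metis subsetD)
  next
    show "I \<noteq> {}" using I.zero_closed by blast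
  qed (use sub in auto)
  then interpret I: abelian_subgroup I L
    by (intro abelian_subgroupI3 additive_subgroupI L.M.abelian_group_axioms)
  have car: "carrier ?Q = ?c ` carrier L"
    by (auto simp: quotient_superalg_def A_RCOSETS_def RCOSETS_def a_r_coset_def)
  have zero: "\<zero>\<^bsub>?Q\<^esub> = ?c \<zero>\<^bsub>L\<^esub>"
    using L.M.a_coset_add_zero[OF sub] by (simp add: quotient_superalg_def)
  have add: "?c x \<oplus>\<^bsub>?Q\<^esub> ?c y = ?c (x \<oplus>\<^bsub>L\<^esub> y)" if "x \<in> carrier L" "y \<in> carrier L" for x y
    using I.a_rcos_sum[OF that] by (simp add: quotient_superalg_def)
  have smult: "k \<odot>\<^bsub>?Q\<^esub> ?c x = ?c (k \<odot>\<^bsub>L\<^esub> x)" if k: "k \<in> carrier K" and x: "x \<in> carrier L" for k x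
  proof -
    \<comment> \<open>Changing the representative by \<open>h\<close> in \<open>I\<close> changes
      the multiple by \<open>k h\<close>, again in \<open>I\<close>; so the union defining
      \<open>smult\<close> runs over a single coset.\<close>
    have "?c (k \<odot>\<^bsub>L\<^esub> x') = ?c (k \<odot>\<^bsub>L\<^esub> x)" if x': "x' \<in> ?c x" for x'
    proof -
      obtain h where h: "h \<in> I" "x' = h \<oplus>\<^bsub>L\<^esub> x"
        using x' by (auto simp: a_r_coset_def')
      then have "k \<odot>\<^bsub>L\<^esub> x' = k \<odot>\<^bsub>L\<^esub> h \<oplus>\<^bsub>L\<^esub> k \<odot>\<^bsub>L\<^esub> x"
        using k x sub by (simp add: L.smult_r_distr subset_eq)
      moreover have "k \<odot>\<^bsub>L\<^esub> h \<in> I"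
        using k h by simp
      ultimately have "k \<odot>\<^bsub>L\<^esub> x' \<in> ?c (k \<odot>\<^bsub>L\<^esub> x)"
        by (auto simp: a_r_coset_def')
      then show ?thesis
        using I.a_repr_independence' k x by simp
    qed
    moreover have "x \<in> ?c x"
      using x by (rule I.a_rcos_self)
    ultimately have "(\<Union>x'\<in>?c x. ?c (k \<odot>\<^bsub>L\<^esub> x')) = ?c (k \<odot>\<^bsub>L\<^esub> x)"
      by blast
    then show ?thesis
      by (simp add: quotient_superalg_def)
  qed
  show Q: "vectorspace K ?Q"
  proof (rule vs_criteria)
    show "field K" by (rule L.field_axioms)
    show "\<forall>v w. v \<in> carrier ?Q \<and> w \<in> carrier ?Q \<longrightarrow> v \<oplus>\<^bsub>?Q\<^esub> w = w \<oplus>\<^bsub>?Q\<^esub> v"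
      by (auto simp only: car add L.M.a_comm)
    show "\<forall>v\<in>carrier ?Q. \<exists>neg_v\<in>carrier ?Q. v \<oplus>\<^bsub>?Q\<^esub> neg_v = \<zero>\<^bsub>?Q\<^esub>"
    proof
      fix v assume "v \<in> carrier ?Q"
      then obtain x where x: "x \<in> carrier L" "v = ?c x" by (auto simp: car)
      then have "v \<oplus>\<^bsub>?Q\<^esub> ?c (\<ominus>\<^bsub>L\<^esub> x) = \<zero>\<^bsub>?Q\<^esub>"
        by (simp add: add zero L.M.r_neg)
      then show "\<exists>neg_v\<in>carrier ?Q. v \<oplus>\<^bsub>?Q\<^esub> neg_v = \<zero>\<^bsub>?Q\<^esub>"
        using x by (auto simp: car)
    qed
  qed (auto simp: car zero add smult L.M.a_assoc L.smult_l_distr L.smult_r_distr L.smult_assoc1)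
  interpret Q: vectorspace K ?Q by (rule Q)
  show "mod_hom K L ?Q ?c"
    by unfold_locales (auto simp: module_hom_def car add smult)
  show "x \<in> I \<Longrightarrow> ?c x = \<zero>\<^bsub>?Q\<^esub>"
    using I.a_rcos_const[of x] by (simp add: quotient_superalg_def)
qed

section \<open>Homogeneous components and vanishing brackets\<close>

context lie_superalgebra
begin

lemma grade_carrier: "x \<in> grade L \<alpha> \<Longrightarrow> x \<in> carrier L"
  using grade_subspace[of \<alpha>] by (auto simp: subspace_def submodule_def)

lemma grade_neg:
  assumes "x \<in> grade L \<alpha>" shows "\<ominus>\<^bsub>L\<^esub> x \<in> grade L \<alpha>"
proof -
  have "(\<ominus>\<^bsub>K\<^esub> \<one>\<^bsub>K\<^esub>) \<odot>\<^bsub>L\<^esub> x \<in> grade L \<alpha>"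
    using grade_subspace[of \<alpha>] assms by (auto simp: subspace_def submodule_def)
  then show ?thesis
    using grade_carrier[OF assms] by (simp add: smult_minus_1)
qed

lemma grade_decompose:
  assumes "x \<in> carrier L"
  obtains x0 x1 where "x0 \<in> grade L 0" "x1 \<in> grade L 1" "x = x0 \<oplus>\<^bsub>L\<^esub> x1"
  using assms unfolding grade_sum[symmetric] set_add_def' by blast

text \<open>Here \<open>b\<close> is the negative of \<open>a\<close>, so it lies in both graded
  components, which meet only in zero. Writing the degrees as \<alpha> and
  \<open>\<alpha> + 1\<close> covers both orders of the components.\<close>

lemma grade_add_eq_zero:
  assumes a: "a \<in> grade L \<alpha>" and b: "b \<in> grade L (\<alpha> + 1)" and ab: "a \<oplus>\<^bsub>L\<^esub> b = \<zero>\<^bsub>L\<^esub>"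
  shows "a = \<zero>\<^bsub>L\<^esub> \<and> b = \<zero>\<^bsub>L\<^esub>"
proof -
  have c: "a \<in> carrier L" "b \<in> carrier L"
    using a b grade_carrier by auto
  have "b = \<ominus>\<^bsub>L\<^esub> a"
    using ab c by (metis M.a_comm M.minus_equality)
  then have "b \<in> grade L \<alpha>"
    using grade_neg[OF a] by simp
  moreover have "grade L \<alpha> \<inter> grade L (\<alpha> + 1) = {\<zero>\<^bsub>L\<^esub>}"
    using grade_disjoint by (cases \<alpha>) auto
  ultimately have "b = \<zero>\<^bsub>L\<^esub>"
    using b by blast
  then show ?thesis
    using ab c by simp
qed

lemma bracket_zero_left: "y \<in> carrier L \<Longrightarrow> bracket L \<zero>\<^bsub>L\<^esub> y = \<zero>\<^bsub>L\<^esub>"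
  using bracket_smult_left[of "\<zero>\<^bsub>K\<^esub>" "\<zero>\<^bsub>L\<^esub>" y] by (simp add: bracket_closed)

lemma bracket_zero_right: "x \<in> carrier L \<Longrightarrow> bracket L x \<zero>\<^bsub>L\<^esub> = \<zero>\<^bsub>L\<^esub>"
  using bracket_smult_right[of "\<zero>\<^bsub>K\<^esub>" x "\<zero>\<^bsub>L\<^esub>"] by (simp add: bracket_closed)

lemma super_sign_carrier: "super_sign K \<alpha> \<beta> \<in> carrier K"
  by (simp add: super_sign_def)

lemma bracket_eq_zero_commute:
  assumes "x \<in> grade L \<alpha>" "y \<in> grade L \<beta>" "bracket L y x = \<zero>\<^bsub>L\<^esub>"
  shows "bracket L x y = \<zero>\<^bsub>L\<^esub>"
  using super_skew[OF assms(1,2)] assms(3) by (simp add: super_sign_carrier)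

text \<open>Bracketing with a homogeneous element shifts degrees, so the brackets of the even and
  the odd component have different degrees and cannot cancel.\<close>

lemma bracket_homogeneous_left_eq_zero:
  assumes x: "x0 \<in> grade L 0" "x1 \<in> grade L 1" and z: "z \<in> grade L \<beta>"
    and zero: "bracket L (x0 \<oplus>\<^bsub>L\<^esub> x1) z = \<zero>\<^bsub>L\<^esub>"
  shows "bracket L x0 z = \<zero>\<^bsub>L\<^esub> \<and> bracket L x1 z = \<zero>\<^bsub>L\<^esub>"
proof (rule grade_add_eq_zero)
  show "bracket L x0 z \<in> grade L \<beta>"
    using bracket_grade[OF x(1) z] by (simp only: add_0_left)
  show "bracket L x1 z \<in> grade L (\<beta> + 1)"
    using bracket_grade[OF x(2) z] by (simp only: add.commute)
  show "bracket L x0 z \<oplus>\<^bsub>L\<^esub> bracket L x1 z = \<zero>\<^bsub>L\<^esub>"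
    using zero x z grade_carrier by (simp add: bracket_add_left)
qed

lemma bracket_homogeneous_right_eq_zero:
  assumes y: "y0 \<in> grade L 0" "y1 \<in> grade L 1" and x: "x \<in> grade L \<alpha>"
    and zero: "bracket L x (y0 \<oplus>\<^bsub>L\<^esub> y1) = \<zero>\<^bsub>L\<^esub>"
  shows "bracket L x y0 = \<zero>\<^bsub>L\<^esub> \<and> bracket L x y1 = \<zero>\<^bsub>L\<^esub>"
proof (rule grade_add_eq_zero)
  show "bracket L x y0 \<in> grade L \<alpha>"
    using bracket_grade[OF x y(1)] by (simp only: add_0_right)
  show "bracket L x y1 \<in> grade L (\<alpha> + 1)"
    using bracket_grade[OF x y(2)] .
  show "bracket L x y0 \<oplus>\<^bsub>L\<^esub> bracket L x y1 = \<zero>\<^bsub>L\<^esub>"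
    using zero x y grade_carrier by (simp add: bracket_add_right)
qed

section \<open>The center and brackets of its cosets\<close>

lemma center_carrier: "z \<in> center L \<Longrightarrow> z \<in> carrier L"
  by (simp add: center_def)

lemma bracket_center_left: "z \<in> center L \<Longrightarrow> x \<in> carrier L \<Longrightarrow> bracket L z x = \<zero>\<^bsub>L\<^esub>"
  by (simp add: center_def)

text \<open>\<open>center\<close> is defined by left brackets only, and super skew-symmetry is
  available only for homogeneous elements. Hence both arguments are split: the components of
  \<open>z\<close> kill every homogeneous element from the left, and there the sides may be
  exchanged.\<close>

lemma bracket_center_right:
  assumes z: "z \<in> center L" and x: "x \<in> carrier L"
  shows "bracket L x z = \<zero>\<^bsub>L\<^esub>"
proof -
  obtain z0 z1 where z01: "z0 \<in> grade L 0" "z1 \<in> grade L 1" "z = z0 \<oplus>\<^bsub>L\<^esub> z1"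
    using grade_decompose[OF center_carrier[OF z]] .
  obtain x0 x1 where x01: "x0 \<in> grade L 0" "x1 \<in> grade L 1" "x = x0 \<oplus>\<^bsub>L\<^esub> x1"
    using grade_decompose[OF x] .
  have "bracket L y z = \<zero>\<^bsub>L\<^esub>" if y: "y \<in> grade L \<beta>" for y \<beta>
  proof -
    have "bracket L z0 y = \<zero>\<^bsub>L\<^esub> \<and> bracket L z1 y = \<zero>\<^bsub>L\<^esub>"
      using bracket_homogeneous_left_eq_zero[OF z01(1,2) y] bracket_center_left[OF z] z01 y
        grade_carrier by simp
    then have "bracket L y z0 = \<zero>\<^bsub>L\<^esub>" "bracket L y z1 = \<zero>\<^bsub>L\<^esub>"
      using bracket_eq_zero_commute y z01 by blast+
    then show ?thesis
      using z01 y grade_carrier by (simp add: bracket_add_right)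
  qed
  then have "bracket L x0 z = \<zero>\<^bsub>L\<^esub>" "bracket L x1 z = \<zero>\<^bsub>L\<^esub>"
    using x01 by blast+
  then show ?thesis
    using x01 z center_carrier grade_carrier by (simp add: bracket_add_left)
qed

lemma center_submodule: "submodule K (center L) L"
  by (rule submodule.intro)
    (auto simp: center_def bracket_add_left bracket_smult_left bracket_zero_left module_axioms)

text \<open>Central summands in either argument drop out of the bracket, so all cosets in the
  defining union coincide.\<close>

lemma bracket_quotient_center:
  assumes x: "x \<in> carrier L" and y: "y \<in> carrier L"
  shows "bracket (quotient_superalg L (center L)) (center L +>\<^bsub>L\<^esub> x) (center L +>\<^bsub>L\<^esub> y) =
    center L +>\<^bsub>L\<^esub> bracket L x y"
proof -
  have eq: "center L +>\<^bsub>L\<^esub> bracket L x' y' = center L +>\<^bsub>L\<^esub> bracket L x y"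
    if x': "x' \<in> center L +>\<^bsub>L\<^esub> x" and y': "y' \<in> center L +>\<^bsub>L\<^esub> y" for x' y'
  proof -
    obtain z w where "z \<in> center L" "x' = z \<oplus>\<^bsub>L\<^esub> x" "w \<in> center L" "y' = w \<oplus>\<^bsub>L\<^esub> y"
      using x' y' by (auto simp: a_r_coset_def')
    then show ?thesis
      using x y by (simp add: bracket_add_left bracket_add_right bracket_center_left
          bracket_center_right center_carrier bracket_closed)
  qed
  have mem: "x \<in> center L +>\<^bsub>L\<^esub> x" "y \<in> center L +>\<^bsub>L\<^esub> y"
    using submodule.zero_closed[OF center_submodule] x y M.l_zero
    by (force simp: a_r_coset_def')+
  have "(\<Union>x'\<in>center L +>\<^bsub>L\<^esub> x. \<Union>y'\<in>center L +>\<^bsub>L\<^esub> y. center L +>\<^bsub>L\<^esub> bracket L x' y') =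
    center L +>\<^bsub>L\<^esub> bracket L x y"
    by (intro SUP_eq_const eq) (use mem in blast)+
  then show ?thesis
    by (simp add: quotient_superalg_def)
qed

section \<open>Centralizers of homogeneous elements\<close>

text \<open>For homogeneous arguments two of the three terms of the super Jacobi identity vanish,
  leaving the claim up to sign. The general case follows because the components of \<open>y\<close>
  and \<open>z\<close> also commute with the homogeneous \<open>x\<close>.\<close>

lemma centralizer_bracket_closed:
  assumes x: "x \<in> grade L \<alpha>" and yz: "y \<in> carrier L" "z \<in> carrier L"
    and y: "bracket L x y = \<zero>\<^bsub>L\<^esub>" and z: "bracket L x z = \<zero>\<^bsub>L\<^esub>"
  shows "bracket L x (bracket L y z) = \<zero>\<^bsub>L\<^esub>"
proof -
  have hom: "bracket L x (bracket L v w) = \<zero>\<^bsub>L\<^esub>"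
    if v: "v \<in> grade L \<beta>" "bracket L x v = \<zero>\<^bsub>L\<^esub>" and w: "w \<in> grade L \<gamma>" "bracket L x w = \<zero>\<^bsub>L\<^esub>"
    for v w \<beta> \<gamma>
  proof -
    have c: "x \<in> carrier L" "v \<in> carrier L" "w \<in> carrier L"
      using x v w grade_carrier by auto
    \<comment> \<open>The Jacobi identity contains \<open>bracket L w x\<close>, with
      \<open>x\<close> on the right, so the hypothesis on \<open>w\<close> has to be turned
      round.\<close>
    have "bracket L w x = \<zero>\<^bsub>L\<^esub>"
      using bracket_eq_zero_commute[OF w(1) x] w(2) by simp
    then have *: "super_sign K \<alpha> \<gamma> \<odot>\<^bsub>L\<^esub> bracket L x (bracket L v w) = \<zero>\<^bsub>L\<^esub>"
      using super_jacobi[OF x v(1) w(1)] v(2) c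
      by (simp add: bracket_zero_right bracket_closed super_sign_carrier)
    have "bracket L x (bracket L v w) \<in> carrier L"
      using c bracket_closed by simp
    then show ?thesis
      using * by (auto simp: super_sign_def smult_minus_1 split: if_splits)
  qed
  obtain y0 y1 where y01: "y0 \<in> grade L 0" "y1 \<in> grade L 1" "y = y0 \<oplus>\<^bsub>L\<^esub> y1"
    using grade_decompose[OF yz(1)] .
  obtain z0 z1 where z01: "z0 \<in> grade L 0" "z1 \<in> grade L 1" "z = z0 \<oplus>\<^bsub>L\<^esub> z1"
    using grade_decompose[OF yz(2)] .
  note y' = bracket_homogeneous_right_eq_zero[OF y01(1,2) x y[unfolded y01(3)]]
  note z' = bracket_homogeneous_right_eq_zero[OF z01(1,2) x z[unfolded z01(3)]]
  have "bracket L x (bracket L y0 z0) = \<zero>\<^bsub>L\<^esub>" "bracket L x (bracket L y0 z1) = \<zero>\<^bsub>L\<^esub>"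
    "bracket L x (bracket L y1 z0) = \<zero>\<^bsub>L\<^esub>" "bracket L x (bracket L y1 z1) = \<zero>\<^bsub>L\<^esub>"
    using hom y01(1,2) z01(1,2) y' z' by blast+
  then show ?thesis
    using y01 z01 x grade_carrier
    by (simp add: bracket_add_left bracket_add_right bracket_closed)
qed

lemma centralizer_submodule:
  assumes "x \<in> carrier L"
  shows "submodule K {y \<in> carrier L. bracket L x y = \<zero>\<^bsub>L\<^esub>} L"
  using assms
  by (intro submodule.intro)
    (auto simp: bracket_add_right bracket_smult_right bracket_zero_right module_axioms)

text \<open>The image of the centralizer of \<open>x\<close> in the quotient is a sub-superalgebra
  containing the generators, hence everything. So every element of \<open>L\<close> is a
  centralizing element plus a central one, and \<open>x\<close> commutes with both.\<close>

lemma centralizes_generators_imp_center: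
  assumes x: "x \<in> grade L \<alpha>" and S: "S \<subseteq> carrier L"
    and cent: "\<And>s. s \<in> S \<Longrightarrow> bracket L x s = \<zero>\<^bsub>L\<^esub>"
    and gen: "generated_superalgebra K (quotient_superalg L (center L))
      ((\<lambda>s. center L +>\<^bsub>L\<^esub> s) ` S) = carrier (quotient_superalg L (center L))"
  shows "x \<in> center L"
proof -
  define C where "C = {y \<in> carrier L. bracket L x y = \<zero>\<^bsub>L\<^esub>}"
  let ?Q = "quotient_superalg L (center L)" and ?c = "\<lambda>s. center L +>\<^bsub>L\<^esub> s"
  have V: "vectorspace K L" ..
  interpret c: mod_hom K L ?Q ?c
    by (rule mod_hom_quotient[OF V center_submodule])
  have xL: "x \<in> carrier L" by (rule grade_carrier[OF x])
  have C: "submodule K C L"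
    unfolding C_def by (rule centralizer_submodule[OF xL])
  have image: "submodule K (?c ` C) ?Q"
    by (rule c.submodule_image[OF C])
  have gradeQ: "grade ?Q \<beta> = ?c ` grade L \<beta>" for \<beta>
    by (simp add: quotient_superalg_def)
  have "sub_superalgebra K (?c ` C) ?Q"
    unfolding sub_superalgebra_def
  proof (intro conjI ballI)
    show "subspace K (?c ` C) ?Q"
      by (intro subspace.intro vectorspace_quotient V center_submodule image)
    show "?c ` C = (?c ` C \<inter> grade ?Q 0) <+>\<^bsub>?Q\<^esub> (?c ` C \<inter> grade ?Q 1)"
    proof
      show "(?c ` C \<inter> grade ?Q 0) <+>\<^bsub>?Q\<^esub> (?c ` C \<inter> grade ?Q 1) \<subseteq> ?c ` C"
        using submodule.m_closed[OF image] by (auto simp: set_add_def' simp del: c.f_add)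
      show "?c ` C \<subseteq> (?c ` C \<inter> grade ?Q 0) <+>\<^bsub>?Q\<^esub> (?c ` C \<inter> grade ?Q 1)"
      proof
        fix v assume "v \<in> ?c ` C"
        then obtain y where y: "y \<in> carrier L" "bracket L x y = \<zero>\<^bsub>L\<^esub>" "v = ?c y"
          by (auto simp: C_def)
        obtain y0 y1 where y01: "y0 \<in> grade L 0" "y1 \<in> grade L 1" "y = y0 \<oplus>\<^bsub>L\<^esub> y1"
          using grade_decompose[OF y(1)] .
        \<comment> \<open>Homogeneity of \<open>x\<close> makes its centralizer graded, and the
          grading passes to the image.\<close>
        have "y0 \<in> C" "y1 \<in> C"
          using bracket_homogeneous_right_eq_zero[OF y01(1,2) x] y y01 grade_carrier
          by (auto simp: C_def)
        moreover have "v = ?c y0 \<oplus>\<^bsub>?Q\<^esub> ?c y1"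
          using y(3) y01 grade_carrier by simp
        ultimately show "v \<in> (?c ` C \<inter> grade ?Q 0) <+>\<^bsub>?Q\<^esub> (?c ` C \<inter> grade ?Q 1)"
          unfolding gradeQ set_add_def' using y01(1,2) by blast
      qed
    qed
  next
    fix v w assume "v \<in> ?c ` C" "w \<in> ?c ` C"
    then obtain y z where yz: "y \<in> C" "v = ?c y" "z \<in> C" "w = ?c z"
      by blast
    then have "bracket ?Q v w = ?c (bracket L y z)"
      by (simp add: bracket_quotient_center C_def)
    moreover have "bracket L y z \<in> C"
      using yz centralizer_bracket_closed[OF x] bracket_closed by (auto simp: C_def)
    ultimately show "bracket ?Q v w \<in> ?c ` C"
      by simp
  qed
  moreover have "?c ` S \<subseteq> ?c ` C"
    using S cent by (auto simp: C_def)
  ultimately have sub: "carrier ?Q \<subseteq> ?c ` C"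
    using gen unfolding generated_superalgebra_def by blast
  have "bracket L x y = \<zero>\<^bsub>L\<^esub>" if y: "y \<in> carrier L" for y
  proof -
    obtain y' where y': "y' \<in> C" "?c y = ?c y'"
      using sub c.f_im[OF y] by blast
    \<comment> \<open>Equality of cosets is turned into \<open>y = z + y'\<close> with
      \<open>z\<close> central, by viewing \<open>y\<close> as a member of the coset of
      \<open>y'\<close>.\<close>
    have "y \<in> ?c y"
      using submodule.zero_closed[OF center_submodule] y M.l_zero by (force simp: a_r_coset_def')
    then obtain z where "z \<in> center L" "y = z \<oplus>\<^bsub>L\<^esub> y'"
      unfolding y'(2) by (auto simp: a_r_coset_def')
    then show ?thesis
      using y' xL by (simp add: C_def bracket_add_right bracket_center_right center_carrier)
  qed
  then show ?thesis
    using xL by (simp add: center_def)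
qed

section \<open>The derived algebra and the dimension bound\<close>

lemma commutators_carrier: "commutators L \<subseteq> carrier L"
  by (auto simp: commutators_def bracket_closed)

lemma derived_submodule: "submodule K (derived K L) L"
  unfolding derived_def by (rule span_is_submodule[OF commutators_carrier])

lemma bracket_derived: "x \<in> carrier L \<Longrightarrow> y \<in> carrier L \<Longrightarrow> bracket L x y \<in> derived K L"
  using in_own_span[OF commutators_carrier] by (auto simp: derived_def commutators_def)

lemma derived_vectorspace: "vectorspace K (L\<lparr>carrier := derived K L\<rparr>)"
  by (intro subspace_is_vs subspace.intro vectorspace_axioms derived_submodule)

lemma derived_fin_dim:
  assumes "finite (commutators L)"
  shows "vectorspace.fin_dim K (L\<lparr>carrier := derived K L\<rparr>)"
proof -
  interpret D: vectorspace K "L\<lparr>carrier := derived K L\<rparr>" by (rule derived_vectorspace)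
  have sub: "commutators L \<subseteq> derived K L"
    unfolding derived_def by (rule in_own_span[OF commutators_carrier])
  \<comment> \<open>The finite set spans \<open>derived K L\<close> inside \<open>L\<close> by
    definition; the span taken within the subspace is the same.\<close>
  have "D.span (commutators L) = derived K L"
    using span_li_not_depend(1)[OF sub derived_submodule] by (simp add: derived_def)
  then show ?thesis
    unfolding D.fin_dim_def using assms sub by auto
qed

text \<open>Lift the generators to \<open>L\<close> and bracket with each of them: these are
  \<open>m + n\<close> linear maps into the derived algebra with joint kernel inside the center. The
  resulting \<open>A\<close> spans \<open>L\<close> together with the center, so the cosets of
  \<open>A\<close> span the quotient.\<close>

lemma quotient_center_dim_le:
  assumes fd: "vectorspace.fin_dim K (L\<lparr>carrier := derived K L\<rparr>)"
    and gen: "generated_by K (quotient_superalg L (center L)) m n"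
  shows "vectorspace.fin_dim K (quotient_superalg L (center L)) \<and>
    vectorspace.dim K (quotient_superalg L (center L))
      \<le> (m + n) * vectorspace.dim K (L\<lparr>carrier := derived K L\<rparr>)"
proof -
  let ?Q = "quotient_superalg L (center L)" and ?c = "\<lambda>s. center L +>\<^bsub>L\<^esub> s"
  let ?D = "L\<lparr>carrier := derived K L\<rparr>"
  have V: "vectorspace K L" ..
  interpret Q: vectorspace K ?Q by (rule vectorspace_quotient[OF V center_submodule])
  interpret D: vectorspace K ?D by (rule derived_vectorspace)
  have c_hom: "mod_hom K L ?Q ?c"
    by (rule mod_hom_quotient[OF V center_submodule])
  interpret c: mod_hom K L ?Q ?c by (rule c_hom)
  obtain xs ys where xys: "length xs = m" "set xs \<subseteq> ?c ` grade L 0"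
    "length ys = n" "set ys \<subseteq> ?c ` grade L 1"
    "generated_superalgebra K ?Q (set xs \<union> set ys) = carrier ?Q"
    using gen by (auto simp: generated_by_def quotient_superalg_def)
  \<comment> \<open>The even generators of the quotient are cosets of even elements of
    \<open>L\<close>; lifting them as a list keeps the length, and homogeneity of the lifts is
    needed below. The odd ones are treated alike.\<close>
  obtain us where us: "xs = map ?c us" "set us \<subseteq> grade L 0"
  proof -
    have "xs \<in> map ?c ` lists (grade L 0)"
      using xys(2) unfolding lists_image[symmetric] by (simp add: in_lists_conv_set subset_eq)
    then show thesis
      using that by (auto simp: in_lists_conv_set)
  qed
  obtain vs where vs: "ys = map ?c vs" "set vs \<subseteq> grade L 1"
  proof -
    have "ys \<in> map ?c ` lists (grade L 1)"
      using xys(4) unfolding lists_image[symmetric] by (simp add: in_lists_conv_set subset_eq)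
    then show thesis
      using that by (auto simp: in_lists_conv_set)
  qed
  let ?S = "set (us @ vs)"
  have gen': "generated_superalgebra K ?Q (?c ` ?S) = carrier ?Q"
    using xys(5) us(1) vs(1) by (simp add: image_Un)
  have hom: "\<exists>\<beta>. s \<in> grade L \<beta>" if "s \<in> ?S" for s
    using that us(2) vs(2) by auto
  have S: "?S \<subseteq> carrier L"
    using hom grade_carrier by blast
  let ?fs = "map (\<lambda>s u. bracket L u s) (us @ vs)"
  have "\<exists>A. finite A \<and> A \<subseteq> carrier L \<and> card A \<le> length ?fs * D.dim \<and>
    carrier L \<subseteq> span (A \<union> center L)"
  proof (rule joint_kernel_spanning_set[OF derived_vectorspace fd V])
    show "mod_hom K L ?D f" if "f \<in> set ?fs" for f
    proof -
      obtain s where "s \<in> ?S" "f = (\<lambda>u. bracket L u s)"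
        using \<open>f \<in> set ?fs\<close> by auto
      then show ?thesis
        using S by unfold_locales
          (auto simp: module_hom_def bracket_derived bracket_add_left bracket_smult_left)
    qed
    show "submodule K (carrier L) L"
      by (rule submodule.intro) (auto intro: module_axioms)
    show "center L \<subseteq> carrier L"
      using center_carrier by blast
    show "{u \<in> carrier L. \<forall>f\<in>set ?fs. f u = \<zero>\<^bsub>?D\<^esub>} \<subseteq> center L"
    proof safe
      fix u assume u: "u \<in> carrier L" and "\<forall>f\<in>set ?fs. f u = \<zero>\<^bsub>?D\<^esub>"
      then have zero: "bracket L u s = \<zero>\<^bsub>L\<^esub>" if "s \<in> ?S" for s
        using that by auto
      \<comment> \<open>The centralizer argument needs a homogeneous element, so it is applied to
        each component; these still commute with the homogeneous generators.\<close>
      obtain u0 u1 where u01: "u0 \<in> grade L 0" "u1 \<in> grade L 1" "u = u0 \<oplus>\<^bsub>L\<^esub> u1"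
        using grade_decompose[OF u] .
      have "bracket L u0 s = \<zero>\<^bsub>L\<^esub> \<and> bracket L u1 s = \<zero>\<^bsub>L\<^esub>" if s: "s \<in> ?S" for s
        using hom[OF s] zero[OF s] bracket_homogeneous_left_eq_zero[OF u01(1,2)] u01(3) by blast
      then have "u0 \<in> center L" "u1 \<in> center L"
        using centralizes_generators_imp_center[OF _ S _ gen'] u01(1,2) by blast+
      then show "u \<in> center L"
        using u01(3) submodule.m_closed[OF center_submodule] by simp
    qed
  qed
  then obtain A where A: "finite A" "A \<subseteq> carrier L" "card A \<le> (m + n) * D.dim"
    "carrier L \<subseteq> span (A \<union> center L)"
    using us(1) vs(1) xys(1,3) by auto
  have imA: "?c ` A \<subseteq> carrier ?Q"
    using A(2) by auto
  \<comment> \<open>Spanning is transferred to the quotient by pulling back: \<open>P\<close>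
    contains \<open>A\<close>, and it contains the center because central cosets are zero; being a
    submodule, it is all of \<open>L\<close>.\<close>
  define P where "P = {x \<in> carrier L. ?c x \<in> Q.span (?c ` A)}"
  have P: "submodule K P L"
    unfolding P_def by (rule submodule_vimage[OF c_hom Q.span_is_submodule[OF imA]])
  have "A \<union> center L \<subseteq> P"
    using A(2) Q.in_own_span[OF imA] center_carrier coset_eq_zero[OF V center_submodule]
    by (auto simp: P_def Q.span_zero)
  then have "carrier L \<subseteq> P"
    using A(4) span_is_subset[OF _ P] by blast
  moreover have "carrier ?Q = ?c ` carrier L"
    by (auto simp: quotient_superalg_def A_RCOSETS_def RCOSETS_def a_r_coset_def)
  ultimately have "carrier ?Q \<subseteq> Q.span (?c ` A)"
    by (auto simp: P_def)
  then have span: "Q.gen_set (?c ` A)"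
    using Q.span_is_subset2[OF imA] by blast
  have fin: "finite (?c ` A)"
    using A(1) by simp
  have "Q.dim \<le> card (?c ` A)"
    by (rule Q.gen_ge_dim[OF fin imA span])
  then have "Q.dim \<le> (m + n) * D.dim"
    using card_image_le[OF A(1), of ?c] A(3) by linarith
  moreover have Q.fin_dim
    unfolding Q.fin_dim_def using fin imA span by blast
  ultimately show ?thesis by blast
qed

end

theorem theorem4p3:
  fixes K :: "('a, 'm) ring_scheme" and L :: "('a, 'b, 'n) superalg_scheme"
  assumes "lie_superalgebra K L"
    and "field_char K \<noteq> 2" and "field_char K \<noteq> 3"
    and "finite (commutators L)"
  shows "vectorspace.fin_dim K (L\<lparr>carrier := derived K L\<rparr>) \<and>
    (\<forall>m n. generated_by K (quotient_superalg L (center L)) m n \<longrightarrow>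
       vectorspace.fin_dim K (quotient_superalg L (center L)) \<and>
       vectorspace.dim K (quotient_superalg L (center L))
         \<le> (m + n) * vectorspace.dim K (L\<lparr>carrier := derived K L\<rparr>))"
  using lie_superalgebra.derived_fin_dim[OF assms(1,4)]
    lie_superalgebra.quotient_center_dim_le[OF assms(1)]
  by blast

end
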